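(* Let $m>0$, $k>0$, $M>0$ be real constants, and consider coordinates $(I_1,I_2,I_3,\phi^1,\phi^2,\phi^3)$ on the domain where $I_1,I_2,I_3\neq 0$. Let $\tilde N_1=1$, $\tilde N_2=M$, $\tilde N_3=1$, and set $$H'=-\frac{mk^2}{2I_3^2},\qquad \omega'=\sum_{j=1}^3\frac{1}{\tilde N_j}\,dI_j\wedge d\phi^j,\qquad X_{H'}=\frac{mk^2}{I_3^3}\frac{\partial}{\partial\phi^3},$$ and, for each $h\in\mathbb{N}$, $$\tilde\omega_h=\sum_{j=1}^3 \tilde N_j^{-(h+1)}I_j^{-h}\,dI_j\wedge d\phi^j,\qquad F_h=-\frac{mk^2}{(2+h)\,I_3^{2+h}}\qquad (F_0\equiv H').$$ Then for each $h\in\mathbb{N}$ the vector field $X_{H'}$ is a bi-Hamiltonian vector field with respect to $(\omega',\tilde\omega_h)$, i.e. $$\iota_{X_{H'}}\omega'=-dH',\qquad \iota_{X_{H'}}\tilde\omega_h=-dF_h,\qquad X_{H'}=\{H',\cdot\}=\{F_h,\cdot\}_{\tilde\omega_h},$$ and the functions $F_h$ are integrals of motion for $X_{H'}$.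
   Context: $(I,\phi)$ are Delaunay-type action-angle variables of the noncommutative Kepler system (negative energy), and $M$ is a constant depending on the deformation parameters; $0\in\mathbb{N}$. The brackets are $$\{f,g\}=\sum_{j=1}^3\tilde N_j\left(\frac{\partial f}{\partial I_j}\frac{\partial g}{\partial\phi^j}-\frac{\partial f}{\partial\phi^j}\frac{\partial g}{\partial I_j}\right)$$ (the bracket of the bivector $P'=\sum_j\tilde N_j\,\partial_{I_j}\wedge\partial_{\phi^j}$), and $$\{f,g\}_{\tilde\omega_h}=\sum_{j=1}^3\tilde N_j^{h+1}I_j^{h}\left(\frac{\partial f}{\partial I_j}\frac{\partial g}{\partial\phi^j}-\frac{\partial f}{\partial\phi^j}\frac{\partial g}{\partial I_j}\right)$$ (the bracket of the bivector $\tilde P_h=\sum_j\tilde N_j^{h+1}I_j^h\,\partial_{I_j}\wedge\partial_{\phi^j}$). The interior product convention is $\iota_X(df\wedge dg)=(Xf)\,dg-(Xg)\,df$. A function $F$ is an integral of motion for $X$ if $X(F)=0$. *)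

theory Defs
  imports "HOL-Analysis.Analysis"
begin

text \<open>A point is a pair \<open>(I, \<phi>)\<close> of action and angle coordinates. The angles are real-valued
  coordinates. The index type \<open>3\<close> has the elements \<open>1, 2, 3\<close>.\<close>

type_synonym phase = "(real^3) \<times> (real^3)"
type_synonym vfield = "phase \<Rightarrow> phase"
type_synonym form1 = "phase \<Rightarrow> phase \<Rightarrow> real"
type_synonym form2 = "phase \<Rightarrow> phase \<Rightarrow> phase \<Rightarrow> real"

definition action :: "3 \<Rightarrow> phase \<Rightarrow> real" where
  "action j p = fst p $ j"

definition angle :: "3 \<Rightarrow> phase \<Rightarrow> real" where
  "angle j p = snd p $ j"

definition phase_domain :: "phase set" where
  "phase_domain = {p. \<forall>j. action j p \<noteq> 0}"

definition differential :: "(phase \<Rightarrow> real) \<Rightarrow> form1" where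
  "differential f p = frechet_derivative f (at p)"

definition vf_apply :: "vfield \<Rightarrow> (phase \<Rightarrow> real) \<Rightarrow> phase \<Rightarrow> real" where
  "vf_apply X f p = differential f p (X p)"

definition del_action :: "3 \<Rightarrow> vfield" where
  "del_action j p = (axis j 1, 0)"

definition del_angle :: "3 \<Rightarrow> vfield" where
  "del_angle j p = (0, axis j 1)"

definition wedge :: "form1 \<Rightarrow> form1 \<Rightarrow> form2" where
  "wedge \<alpha> \<beta> p u v = \<alpha> p u * \<beta> p v - \<alpha> p v * \<beta> p u"

text \<open>With this wedge product, contraction in the first slot gives
  \<open>\<iota>\<^sub>X (df \<and> dg) = (X f) dg - (X g) df\<close>.\<close>

definition interior_prod :: "vfield \<Rightarrow> form2 \<Rightarrow> form1" where
  "interior_prod X \<omega> p v = \<omega> p (X p) v"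

text \<open>The bracket of the bivector \<open>\<Sum>\<^sub>j c\<^sub>j \<partial>\<^bsub>I\<^sub>j\<^esub> \<and> \<partial>\<^bsub>\<phi>\<^sup>j\<^esub>\<close> with coefficient functions \<open>c\<^sub>j\<close>.\<close>

definition bracket ::
  "(3 \<Rightarrow> phase \<Rightarrow> real) \<Rightarrow> (phase \<Rightarrow> real) \<Rightarrow> (phase \<Rightarrow> real) \<Rightarrow> phase \<Rightarrow> real" where
  "bracket c f g p = (\<Sum>j\<in>UNIV. c j p *
     (vf_apply (del_action j) f p * vf_apply (del_angle j) g p
      - vf_apply (del_angle j) f p * vf_apply (del_action j) g p))"

definition integral_of_motion :: "vfield \<Rightarrow> (phase \<Rightarrow> real) \<Rightarrow> bool" where
  "integral_of_motion X F \<longleftrightarrow> (\<forall>p\<in>phase_domain. vf_apply X F p = 0)"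

definition N :: "real \<Rightarrow> 3 \<Rightarrow> real" where
  "N M j = (if j = 2 then M else 1)"

definition H' :: "real \<Rightarrow> real \<Rightarrow> phase \<Rightarrow> real" where
  "H' m k p = - (m * k^2 / (2 * (action 3 p)^2))"

definition F :: "real \<Rightarrow> real \<Rightarrow> nat \<Rightarrow> phase \<Rightarrow> real" where
  "F m k h p = - (m * k^2 / ((2 + real h) * (action 3 p)^(2 + h)))"

definition X_H' :: "real \<Rightarrow> real \<Rightarrow> vfield" where
  "X_H' m k p = (m * k^2 / (action 3 p)^3) *\<^sub>R del_angle 3 p"

definition \<omega>' :: "real \<Rightarrow> form2" where
  "\<omega>' M p u v = (\<Sum>j\<in>UNIV. 1 / N M j * wedge (differential (action j)) (differential (angle j)) p u v)"

definition \<omega>_tilde :: "real \<Rightarrow> nat \<Rightarrow> form2" where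
  "\<omega>_tilde M h p u v =
     (\<Sum>j\<in>UNIV. N M j powi (- (int h + 1)) * action j p powi (- int h)
        * wedge (differential (action j)) (differential (angle j)) p u v)"

definition bracket' :: "real \<Rightarrow> (phase \<Rightarrow> real) \<Rightarrow> (phase \<Rightarrow> real) \<Rightarrow> phase \<Rightarrow> real" where
  "bracket' M = bracket (\<lambda>j p. N M j)"

definition bracket_tilde ::
  "real \<Rightarrow> nat \<Rightarrow> (phase \<Rightarrow> real) \<Rightarrow> (phase \<Rightarrow> real) \<Rightarrow> phase \<Rightarrow> real" where
  "bracket_tilde M h = bracket (\<lambda>j p. N M j ^ (h + 1) * action j p ^ h)"

end

theory Submission imports Defs begin

text \<open>Everything reduces to the pair (I_3, \<phi>^3). Since F_h depends on I_3 alone, dF_h =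
  (m k^2 / I_3^(3+h)) dI_3 (\<open>differential_F\<close>). Since the field points along \<phi>^3,
  contracting it with \<Sum>_j c_j dI_j \<and> d\<phi>^j leaves only -c_3 (m k^2 / I_3^3) dI_3
  (\<open>interior_prod_X_H'\<close>), and bracketing with F_h leaves only a multiple of
  \<partial>/\<partial>\<phi>^3 (\<open>bracket_F\<close>). What remains is to match powers of I_3
  at j = 3, where \<open>N M 3 = 1\<close>: the weight I_3^(-h) of the form turns I_3^(-3) into
  I_3^(-3-h), and the weight I_3^h of the bivector undoes this.\<close>

lemma differential_eqI:
  assumes "(f has_derivative D) (at p)"
  shows "differential f p = D"
  unfolding differential_def using frechet_derivative_at[OF assms] by simp

lemma has_derivative_action: "(action j has_derivative (\<lambda>v. fst v $ j)) (at p)"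
  unfolding action_def [abs_def]
  by (intro bounded_linear_imp_has_derivative bounded_linear_compose[OF bounded_linear_vec_nth]
      bounded_linear_fst)

lemma has_derivative_angle: "(angle j has_derivative (\<lambda>v. snd v $ j)) (at p)"
  unfolding angle_def [abs_def]
  by (intro bounded_linear_imp_has_derivative bounded_linear_compose[OF bounded_linear_vec_nth]
      bounded_linear_snd)

lemmas differential_action = differential_eqI[OF has_derivative_action]
lemmas differential_angle = differential_eqI[OF has_derivative_angle]

text \<open>Read from right to left, this makes the claims about \<open>H'\<close> instances of the
  formulas for \<open>F\<close>.\<close>

lemma F_0_eq_H': "F m k 0 = H' m k"
  by (simp add: F_def H'_def fun_eq_iff)

text \<open>Chain rule through the linear coordinate \<open>action 3\<close>; the factor 2 + h
  produced by the power cancels the one in the denominator of \<open>F\<close>.\<close>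

lemma differential_F:
  assumes "action 3 p \<noteq> 0"
  shows "differential (F m k h) p = (\<lambda>v. m * k^2 / action 3 p ^ (3 + h) * fst v $ 3)"
proof (rule differential_eqI)
  let ?x = "action 3 p"
  have "((\<lambda>x. - (m * k^2 / ((2 + real h) * x ^ (2 + h)))) has_real_derivative
      m * k^2 / ?x ^ (3 + h)) (at ?x)"
    using assms
    by (intro DERIV_cong[OF DERIV_minus[OF DERIV_divide[OF DERIV_const DERIV_cmult[OF DERIV_pow]]]])
       (simp_all add: divide_simps power_add power2_eq_square power3_eq_cube)
  from diff_chain_at[OF has_derivative_action this[unfolded has_field_derivative_def]]
  show "(F m k h has_derivative (\<lambda>v. m * k^2 / ?x ^ (3 + h) * fst v $ 3)) (at p)"
    by (simp add: F_def [abs_def] o_def)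
qed

text \<open>Differentiability of \<open>g\<close> makes its Frechet derivative linear, so the scalar
  factor of the field can be pulled out.\<close>

lemma vf_apply_X_H':
  assumes "g differentiable (at p)"
  shows "vf_apply (X_H' m k) g p = m * k^2 / action 3 p ^ 3 * vf_apply (del_angle 3) g p"
  using linear_scale[OF linear_frechet_derivative[OF assms]]
  by (simp add: vf_apply_def differential_def X_H'_def)

lemma vf_apply_del_F:
  assumes "action 3 p \<noteq> 0"
  shows "vf_apply (del_action j) (F m k h) p = (if j = 3 then m * k^2 / action 3 p ^ (3 + h) else 0)"
    and "vf_apply (del_angle j) (F m k h) p = 0"
  by (simp_all add: vf_apply_def differential_F[OF assms] del_action_def del_angle_def axis_def)

text \<open>The coefficients \<open>c\<close> stay arbitrary so that both Poisson brackets are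
  instances.\<close>

lemma bracket_F:
  assumes "action 3 p \<noteq> 0"
  shows "bracket c (F m k h) g p
    = c 3 p * (m * k^2 / action 3 p ^ (3 + h)) * vf_apply (del_angle 3) g p"
  unfolding bracket_def by (simp add: vf_apply_del_F[OF assms] sum_3)

text \<open>The field annihilates every I_j, so only the term -(X \<phi>^3) dI_3 survives; this is
  the source of the minus sign. Both two-forms are instances through \<open>c\<close>.\<close>

lemma interior_prod_X_H':
  "interior_prod (X_H' m k)
     (\<lambda>p u v. \<Sum>j\<in>UNIV. c j p * wedge (differential (action j)) (differential (angle j)) p u v) p v
   = - (c 3 p * (m * k^2 / action 3 p ^ 3) * fst v $ 3)"
  by (simp add: interior_prod_def wedge_def differential_action differential_angle X_H'_def
      del_angle_def sum_3 axis_def)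

theorem proposition3:
  fixes m k M :: real
  assumes "m > 0" and "k > 0" and "M > 0"
  shows "(\<forall>p\<in>phase_domain. F m k 0 p = H' m k p) \<and>
    (\<forall>h::nat.
      (\<forall>p\<in>phase_domain. interior_prod (X_H' m k) (\<omega>' M) p = (\<lambda>v. - differential (H' m k) p v)) \<and>
      (\<forall>p\<in>phase_domain. interior_prod (X_H' m k) (\<omega>_tilde M h) p = (\<lambda>v. - differential (F m k h) p v)) \<and>
      (\<forall>g::phase \<Rightarrow> real. (\<forall>p\<in>phase_domain. g differentiable (at p)) \<longrightarrow>
        (\<forall>p\<in>phase_domain. vf_apply (X_H' m k) g p = bracket' M (H' m k) g p \<and>
                 vf_apply (X_H' m k) g p = bracket_tilde M h (F m k h) g p)) \<and>
      integral_of_motion (X_H' m k) (F m k h))"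
proof (intro conjI allI impI ballI)
  fix p assume "p \<in> phase_domain"
  show "F m k 0 p = H' m k p"
    by (simp add: F_0_eq_H')
next
  fix h :: nat and p assume "p \<in> phase_domain"
  then have p: "action 3 p \<noteq> 0" by (simp add: phase_domain_def)
  show "interior_prod (X_H' m k) (\<omega>' M) p = (\<lambda>v. - differential (H' m k) p v)"
    unfolding \<omega>'_def [abs_def] F_0_eq_H'[symmetric] fun_eq_iff
      interior_prod_X_H'[of m k "\<lambda>j p. 1 / N M j"] differential_F[OF p]
    by (simp add: N_def)
  show "interior_prod (X_H' m k) (\<omega>_tilde M h) p = (\<lambda>v. - differential (F m k h) p v)"
    unfolding \<omega>_tilde_def [abs_def] fun_eq_iff interior_prod_X_H' differential_F[OF p]
    by (simp add: N_def power_int_minus power_add field_simps)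
next
  fix h :: nat and g :: "phase \<Rightarrow> real" and p
  assume g: "\<forall>p\<in>phase_domain. g differentiable (at p)" and "p \<in> phase_domain"
  then have gp: "g differentiable (at p)" and p: "action 3 p \<noteq> 0"
    by (blast, simp add: phase_domain_def)
  show "vf_apply (X_H' m k) g p = bracket' M (H' m k) g p"
    unfolding bracket'_def F_0_eq_H'[symmetric] bracket_F[OF p] vf_apply_X_H'[OF gp]
    by (simp add: N_def)
  show "vf_apply (X_H' m k) g p = bracket_tilde M h (F m k h) g p"
    unfolding bracket_tilde_def bracket_F[OF p] vf_apply_X_H'[OF gp]
    \<comment> \<open>I_3 \<noteq> 0 allows I_3^h to be cancelled against I_3^(3+h).\<close>
    using p by (simp add: N_def power_add)
next
  fix h :: nat
  show "integral_of_motion (X_H' m k) (F m k h)"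
    \<comment> \<open>dF_h sees only the action component of a vector, and that component of the
      field is zero.\<close>
    by (simp add: integral_of_motion_def phase_domain_def vf_apply_def differential_F
        X_H'_def del_angle_def)
qed

end
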